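(* Let $\kappa$ be an infinite cardinal and $S\subseteq\{1,2,3\}$. The algebra $\mathfrak{E}^S_\kappa$ has a qualitative representation if and only if $S\cap\{2,3\}\neq\varnothing$.
   Context: Let $C$ be a set of proper colours with $|C|=\kappa$ and $C^+=\{1'\}\cup C$ ($1'\notin C$). The chromatic algebra $\mathfrak{E}^S_\kappa$: a triple $(x,y,z)\in (C^+)^3$ is consistent if either one of $x,y,z$ equals $1'$ and the other two are equal, or $x,y,z\in C$ and $|\{x,y,z\}|\in S$. The algebra has universe the power set of $C^+$, set-theoretic Boolean operations ($0=\varnothing$, $1=C^+$), identity $\{1'\}$, converse the identity map, and composition $X;Y=\{z:(x,y,z)\text{ consistent for some }x\in X,y\in Y\}$; $\leq$ is inclusion. A qualitative representation of $\mathbf A$ on a set $U$ is an injective Boolean algebra homomorphism $\varphi$ from $\mathbf A$ into the power set of $U\times U$ with $\varphi(0)=\varnothing$, $\varphi(1)=U\times U$, $\varphi(1')=\mathrm{Id}_U$, $\varphi(\breve x)=\varphi(x)^{\smile}$, and $\varphi(x)\circ\varphi(y)\subseteq\varphi(z)$ iff $x;y\leq z$ for all $x,y,z$ ($\circ$ relational composition). *)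

theory Defs
  imports Main
begin

record 'a rel_type_algebra =
  univ :: "'a set"
  join :: "'a \<Rightarrow> 'a \<Rightarrow> 'a"
  meet :: "'a \<Rightarrow> 'a \<Rightarrow> 'a"
  compl :: "'a \<Rightarrow> 'a"
  bottom :: 'a
  unit :: 'a
  ident :: 'a
  conv :: "'a \<Rightarrow> 'a"
  comp :: "'a \<Rightarrow> 'a \<Rightarrow> 'a"

definition leq :: "('a, 'm) rel_type_algebra_scheme \<Rightarrow> 'a \<Rightarrow> 'a \<Rightarrow> bool" where
  "leq A x y \<longleftrightarrow> join A x y = y"

definition qualitative_representation ::
    "('a, 'm) rel_type_algebra_scheme \<Rightarrow> 'u set \<Rightarrow> ('a \<Rightarrow> ('u \<times> 'u) set) \<Rightarrow> bool" where
  "qualitative_representation A U \<phi> \<longleftrightarrow>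
     inj_on \<phi> (univ A) \<and>
     (\<forall>x\<in>univ A. \<phi> x \<subseteq> U \<times> U) \<and>
     (\<forall>x\<in>univ A. \<forall>y\<in>univ A. \<phi> (join A x y) = \<phi> x \<union> \<phi> y) \<and>
     (\<forall>x\<in>univ A. \<forall>y\<in>univ A. \<phi> (meet A x y) = \<phi> x \<inter> \<phi> y) \<and>
     (\<forall>x\<in>univ A. \<phi> (compl A x) = U \<times> U - \<phi> x) \<and>
     \<phi> (bottom A) = {} \<and>
     \<phi> (unit A) = U \<times> U \<and>
     \<phi> (ident A) = Id_on U \<and>
     (\<forall>x\<in>univ A. \<phi> (conv A x) = (\<phi> x)\<inverse>) \<and>
     (\<forall>x\<in>univ A. \<forall>y\<in>univ A. \<forall>z\<in>univ A.
        \<phi> x O \<phi> y \<subseteq> \<phi> z \<longleftrightarrow> leq A (comp A x y) z)"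

text \<open>
  A formula cannot quantify over the type of the base set, so the base is taken to be a set of
  finite sequences of elements of the algebra. This is no restriction: by
  \<open>has_qualitative_representationI\<close> below, a representation on a set of any type yields one of
  this kind (keep only the points that witness injectivity and the failing inclusions).
\<close>

definition has_qualitative_representation :: "('a, 'm) rel_type_algebra_scheme \<Rightarrow> bool" where
  "has_qualitative_representation A \<longleftrightarrow>
     (\<exists>(U :: 'a list set) \<phi>. qualitative_representation A U \<phi>)"

lemma qualitative_representationD:
  assumes "qualitative_representation A U \<phi>"
  shows "inj_on \<phi> (univ A)"
    and "x \<in> univ A \<Longrightarrow> \<phi> x \<subseteq> U \<times> U"
    and "x \<in> univ A \<Longrightarrow> y \<in> univ A \<Longrightarrow> \<phi> (join A x y) = \<phi> x \<union> \<phi> y"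
    and "x \<in> univ A \<Longrightarrow> y \<in> univ A \<Longrightarrow> \<phi> (meet A x y) = \<phi> x \<inter> \<phi> y"
    and "x \<in> univ A \<Longrightarrow> \<phi> (compl A x) = U \<times> U - \<phi> x"
    and "\<phi> (bottom A) = {}"
    and "\<phi> (unit A) = U \<times> U"
    and "\<phi> (ident A) = Id_on U"
    and "x \<in> univ A \<Longrightarrow> \<phi> (conv A x) = (\<phi> x)\<inverse>"
    and "x \<in> univ A \<Longrightarrow> y \<in> univ A \<Longrightarrow> z \<in> univ A \<Longrightarrow>
      \<phi> x O \<phi> y \<subseteq> \<phi> z \<longleftrightarrow> leq A (comp A x y) z"
  using assms unfolding qualitative_representation_def by simp_all

lemma qualitative_representation_restrict:
  fixes f :: "'v \<Rightarrow> 'u"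
  assumes rep: "qualitative_representation A U \<phi>"
    and inj: "inj_on f I" and sub: "f ` I \<subseteq> U"
    and sep: "\<And>x y. x \<in> univ A \<Longrightarrow> y \<in> univ A \<Longrightarrow> x \<noteq> y \<Longrightarrow>
      \<exists>a\<in>f ` I. \<exists>b\<in>f ` I. ((a, b) \<in> \<phi> x) \<noteq> ((a, b) \<in> \<phi> y)"
    and wit: "\<And>x y z. x \<in> univ A \<Longrightarrow> y \<in> univ A \<Longrightarrow> z \<in> univ A \<Longrightarrow> \<not> \<phi> x O \<phi> y \<subseteq> \<phi> z \<Longrightarrow>
      \<exists>a\<in>f ` I. \<exists>b\<in>f ` I. \<exists>c\<in>f ` I. (a, b) \<in> \<phi> x \<and> (b, c) \<in> \<phi> y \<and> (a, c) \<notin> \<phi> z"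
  shows "qualitative_representation A I (\<lambda>x. {(i, j) \<in> I \<times> I. (f i, f j) \<in> \<phi> x})"
    (is "qualitative_representation A I ?\<psi>")
proof -
  note R = qualitative_representationD[OF rep]
  have "inj_on ?\<psi> (univ A)"
  proof (rule inj_onI, rule ccontr)
    fix x y assume *: "x \<in> univ A" "y \<in> univ A" "?\<psi> x = ?\<psi> y" "x \<noteq> y"
    then obtain i j where ij: "i \<in> I" "j \<in> I" "((f i, f j) \<in> \<phi> x) \<noteq> ((f i, f j) \<in> \<phi> y)"
      using sep[of x y] by blast
    then have "((i, j) \<in> ?\<psi> x) \<noteq> ((i, j) \<in> ?\<psi> y)" by simp
    with *(3) show False by simp
  qed
  moreover have "?\<psi> x O ?\<psi> y \<subseteq> ?\<psi> z \<longleftrightarrow> leq A (comp A x y) z"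
    if *: "x \<in> univ A" "y \<in> univ A" "z \<in> univ A" for x y z
  proof -
    have "?\<psi> x O ?\<psi> y \<subseteq> ?\<psi> z \<longleftrightarrow> \<phi> x O \<phi> y \<subseteq> \<phi> z"
    proof
      assume "\<phi> x O \<phi> y \<subseteq> \<phi> z" then show "?\<psi> x O ?\<psi> y \<subseteq> ?\<psi> z" by blast
    next
      assume L: "?\<psi> x O ?\<psi> y \<subseteq> ?\<psi> z"
      show "\<phi> x O \<phi> y \<subseteq> \<phi> z"
      proof (rule ccontr)
        assume "\<not> \<phi> x O \<phi> y \<subseteq> \<phi> z"
        then obtain i j k where ijk: "i \<in> I" "j \<in> I" "k \<in> I"
          "(f i, f j) \<in> \<phi> x" "(f j, f k) \<in> \<phi> y" "(f i, f k) \<notin> \<phi> z"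
          using wit[OF *] by blast
        then have "(i, k) \<in> ?\<psi> x O ?\<psi> y" by blast
        with L have "(i, k) \<in> ?\<psi> z" by blast
        with ijk show False by simp
      qed
    qed
    with R(10)[OF *] show ?thesis by simp
  qed
  moreover have "?\<psi> (ident A) = Id_on I"
  proof -
    show ?thesis using inj sub by (auto simp: R(8) inj_on_def Id_on_iff)
  qed
  moreover have "?\<psi> (unit A) = I \<times> I" "?\<psi> (bottom A) = {}" using sub by (auto simp: R(6,7))
  moreover have "?\<psi> (join A x y) = ?\<psi> x \<union> ?\<psi> y" "?\<psi> (meet A x y) = ?\<psi> x \<inter> ?\<psi> y"
    if *: "x \<in> univ A" "y \<in> univ A" for x y
    using R(3,4)[OF *] by auto
  moreover have "?\<psi> (compl A x) = I \<times> I - ?\<psi> x" "?\<psi> (conv A x) = (?\<psi> x)\<inverse>"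
    if *: "x \<in> univ A" for x
    using sub by (auto simp: R(5,9)[OF *])
  ultimately show ?thesis
    unfolding qualitative_representation_def by (intro conjI ballI) (assumption | blast)+
qed

lemma has_qualitative_representationI:
  fixes A :: "('a, 'm) rel_type_algebra_scheme" and U :: "'u set"
  assumes rep: "qualitative_representation A U \<phi>"
  shows "has_qualitative_representation A"
proof -
  note R = qualitative_representationD[OF rep]
  have "\<forall>x y. \<exists>a b. x \<in> univ A \<and> y \<in> univ A \<and> x \<noteq> y \<longrightarrow>
      a \<in> U \<and> b \<in> U \<and> ((a, b) \<in> \<phi> x) \<noteq> ((a, b) \<in> \<phi> y)"
  proof (intro allI)
    fix x y
    show "\<exists>a b. x \<in> univ A \<and> y \<in> univ A \<and> x \<noteq> y \<longrightarrow>
      a \<in> U \<and> b \<in> U \<and> ((a, b) \<in> \<phi> x) \<noteq> ((a, b) \<in> \<phi> y)"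
    proof (cases "x \<in> univ A \<and> y \<in> univ A \<and> x \<noteq> y")
      case True
      then have "\<phi> x \<noteq> \<phi> y" "\<phi> x \<subseteq> U \<times> U" "\<phi> y \<subseteq> U \<times> U"
        using R(1,2) by (auto dest: inj_onD)
      then show ?thesis by blast
    qed blast
  qed
  then obtain p q where pq: "\<And>x y. x \<in> univ A \<Longrightarrow> y \<in> univ A \<Longrightarrow> x \<noteq> y \<Longrightarrow>
      p x y \<in> U \<and> q x y \<in> U \<and> ((p x y, q x y) \<in> \<phi> x) \<noteq> ((p x y, q x y) \<in> \<phi> y)"
    by metis
  have "\<forall>x y z. \<exists>a b c. x \<in> univ A \<and> y \<in> univ A \<and> z \<in> univ A \<and> \<not> \<phi> x O \<phi> y \<subseteq> \<phi> z \<longrightarrow>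
      a \<in> U \<and> b \<in> U \<and> c \<in> U \<and> (a, b) \<in> \<phi> x \<and> (b, c) \<in> \<phi> y \<and> (a, c) \<notin> \<phi> z"
  proof (intro allI)
    fix x y z
    show "\<exists>a b c. x \<in> univ A \<and> y \<in> univ A \<and> z \<in> univ A \<and> \<not> \<phi> x O \<phi> y \<subseteq> \<phi> z \<longrightarrow>
      a \<in> U \<and> b \<in> U \<and> c \<in> U \<and> (a, b) \<in> \<phi> x \<and> (b, c) \<in> \<phi> y \<and> (a, c) \<notin> \<phi> z"
    proof (cases "x \<in> univ A \<and> y \<in> univ A \<and> z \<in> univ A \<and> \<not> \<phi> x O \<phi> y \<subseteq> \<phi> z")
      case True
      then have "\<phi> x \<subseteq> U \<times> U" "\<phi> y \<subseteq> U \<times> U" using R(2) by blast+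
      with True show ?thesis by blast
    qed blast
  qed
  then obtain r s t where rst: "\<And>x y z. x \<in> univ A \<Longrightarrow> y \<in> univ A \<Longrightarrow> z \<in> univ A \<Longrightarrow>
      \<not> \<phi> x O \<phi> y \<subseteq> \<phi> z \<Longrightarrow> r x y z \<in> U \<and> s x y z \<in> U \<and> t x y z \<in> U \<and>
      (r x y z, s x y z) \<in> \<phi> x \<and> (s x y z, t x y z) \<in> \<phi> y \<and> (r x y z, t x y z) \<notin> \<phi> z"
    by metis
  define f where "f = (\<lambda>l :: 'a list.
    let x = l ! 0; y = l ! 1; z = l ! 2; n = length l in
    if n = 3 then p x y else if n = 4 then q x y
    else if n = 5 then r x y z else if n = 6 then s x y z else t x y z)"
  have f: "p x y = f [x, y, x]" "q x y = f [x, y, x, x]" "r x y z = f [x, y, z, x, x]"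
    "s x y z = f [x, y, z, x, x, x]" "t x y z = f [x, y, z, x, x, x, x]" for x y z
    by (simp_all add: f_def)
  have "\<exists>I. inj_on f I \<and> range f \<inter> U = f ` I"
    using subset_image_inj[of "range f \<inter> U" f UNIV] by auto
  then obtain I where I: "inj_on f I" "f ` I = range f \<inter> U" by metis
  have "qualitative_representation A I (\<lambda>x. {(i, j) \<in> I \<times> I. (f i, f j) \<in> \<phi> x})"
  proof (rule qualitative_representation_restrict[OF rep I(1)])
    show "f ` I \<subseteq> U" using I(2) by blast
  next
    fix x y assume *: "x \<in> univ A" "y \<in> univ A" "x \<noteq> y"
    have "p x y \<in> f ` I" "q x y \<in> f ` I"
      unfolding I(2) using pq[OF *] f by auto
    with pq[OF *] show "\<exists>a\<in>f ` I. \<exists>b\<in>f ` I. ((a, b) \<in> \<phi> x) \<noteq> ((a, b) \<in> \<phi> y)" by blast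
  next
    fix x y z assume *: "x \<in> univ A" "y \<in> univ A" "z \<in> univ A" "\<not> \<phi> x O \<phi> y \<subseteq> \<phi> z"
    have "r x y z \<in> f ` I" "s x y z \<in> f ` I" "t x y z \<in> f ` I"
      unfolding I(2) using rst[OF *] f by auto
    with rst[OF *] show "\<exists>a\<in>f ` I. \<exists>b\<in>f ` I. \<exists>c\<in>f ` I.
        (a, b) \<in> \<phi> x \<and> (b, c) \<in> \<phi> y \<and> (a, c) \<notin> \<phi> z" by blast
  qed
  then show ?thesis unfolding has_qualitative_representation_def by blast
qed

text \<open>The element \<open>None\<close> plays the role of the identity colour \<open>1'\<close>.\<close>

definition colours_plus :: "'c set \<Rightarrow> 'c option set" where
  "colours_plus C = insert None (Some ` C)"

definition consistent ::
    "'c set \<Rightarrow> nat set \<Rightarrow> 'c option \<Rightarrow> 'c option \<Rightarrow> 'c option \<Rightarrow> bool" where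
  "consistent C S x y z \<longleftrightarrow>
     {x, y, z} \<subseteq> colours_plus C \<and>
     (x = None \<and> y = z \<or> y = None \<and> x = z \<or> z = None \<and> x = y \<or>
      {x, y, z} \<subseteq> Some ` C \<and> card {x, y, z} \<in> S)"

definition chromatic_algebra :: "'c set \<Rightarrow> nat set \<Rightarrow> 'c option set rel_type_algebra" where
  "chromatic_algebra C S =
     \<lparr> univ = Pow (colours_plus C),
       join = (\<union>),
       meet = (\<inter>),
       compl = (\<lambda>X. colours_plus C - X),
       bottom = {},
       unit = colours_plus C,
       ident = {None},
       conv = (\<lambda>X. X),
       comp = (\<lambda>X Y. {z. \<exists>x\<in>X. \<exists>y\<in>Y. consistent C S x y z}) \<rparr>"

lemma leq_chromatic_algebra: "leq (chromatic_algebra C S) X Y \<longleftrightarrow> X \<subseteq> Y"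
  by (auto simp: leq_def chromatic_algebra_def)

end

theory Submission
  imports Defs
begin

text \<open>
  If \<open>S \<subseteq> {1}\<close>, then an edge of colour \<open>a\<close> forces, through \<open>{a};(C - {a}) = \<emptyset>\<close>, every edge
  to have colour \<open>a\<close>, so \<open>\<phi> {1', a} = \<phi> 1\<close>, against injectivity.

  Conversely, a representation labels each pair of points with an ultrafilter on the colours, and
  these need not be principal. Take disjoint triangles with principal labels, one for each
  consistent triple of proper colours, as witnesses, and label all pairs of points from different
  triangles with one fixed nonprincipal ultrafilter \<open>p\<close>. A triangle labelled \<open>(a, p, p)\<close> or
  \<open>(p, p, p)\<close> is always consistent: sets in \<open>p\<close> are infinite and closed under intersection,
  so one colour (if \<open>2 \<in> S\<close>) or two different colours (if \<open>3 \<in> S\<close>) can be chosen in them.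
\<close>

section \<open>Nonprincipal ultrafilters\<close>

text \<open>Zorn's lemma applies to the families whose finite intersections all meet
  \<open>A\<close> in an infinite set; a maximal one is an ultrafilter.\<close>

lemma nonprincipal_ultrafilter_exists:
  assumes "infinite A"
  obtains p where "\<And>X. X \<in> p \<Longrightarrow> infinite (X \<inter> A)"
    and "\<And>X Y. X \<in> p \<Longrightarrow> Y \<in> p \<Longrightarrow> X \<inter> Y \<in> p"
    and "\<And>X. X \<in> p \<or> - X \<in> p"
proof -
  let ?fam = "{F. \<forall>G. finite G \<longrightarrow> G \<subseteq> F \<longrightarrow> infinite (\<Inter>G \<inter> A)}"
  have "\<exists>M\<in>?fam. \<forall>F\<in>?fam. M \<subseteq> F \<longrightarrow> F = M"
  proof (rule subset_Zorn')
    fix K assume K: "subset.chain ?fam K"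
    show "\<Union>K \<in> ?fam"
    proof (intro CollectI allI impI)
      fix G assume G: "finite G" "G \<subseteq> \<Union>K"
      show "infinite (\<Inter>G \<inter> A)"
      proof (cases "K = {}")
        \<comment> \<open>The empty chain forces \<open>G = {}\<close>, whose intersection is the
          whole type; here the infinity of \<open>A\<close> enters.\<close>
        case True
        with G assms show ?thesis by simp
      next
        case False
        obtain B where "B \<in> K" "G \<subseteq> B"
          by (rule finite_subset_Union_chain[OF G False K])
        moreover have "K \<subseteq> ?fam" using K by (simp add: subset.chain_def)
        ultimately show ?thesis using G(1) by blast
      qed
    qed
  qed
  then obtain p where "p \<in> ?fam" and max: "\<forall>F\<in>?fam. p \<subseteq> F \<longrightarrow> F = p" ..
  then have p: "infinite (\<Inter>G \<inter> A)" if "finite G" "G \<subseteq> p" for G using that by simp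
  \<comment> \<open>By maximality, adding \<open>X\<close> destroys the defining property; the
    finite subfamily at fault, minus \<open>X\<close>, is the \<open>G\<close> sought.\<close>
  have out: "\<exists>G. finite G \<and> G \<subseteq> p \<and> finite (X \<inter> \<Inter>G \<inter> A)" if "X \<notin> p" for X
  proof -
    have "insert X p \<notin> ?fam" using bspec[OF max, of "insert X p"] that by blast
    then obtain G where G: "finite G" "G \<subseteq> insert X p" "finite (\<Inter>G \<inter> A)" by blast
    have "X \<inter> \<Inter>(G - {X}) \<inter> A \<subseteq> \<Inter>G \<inter> A" by blast
    then have "finite (X \<inter> \<Inter>(G - {X}) \<inter> A)" using G(3) by (rule finite_subset)
    with G show ?thesis by (intro exI[of _ "G - {X}"]) auto
  qed
  \<comment> \<open>Otherwise \<open>G\<close> joined with the family \<open>H\<close> from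
    \<open>out\<close> has a finite trace on \<open>A\<close>, since \<open>\<Inter>G\<close> lies
    in \<open>X\<close>.\<close>
  have into: "X \<in> p" if "finite G" "G \<subseteq> p" "\<Inter>G \<subseteq> X" for X G
  proof (rule ccontr)
    assume "X \<notin> p"
    then obtain H where "finite H" "H \<subseteq> p" "finite (X \<inter> \<Inter>H \<inter> A)" using out by blast
    moreover have "\<Inter>(G \<union> H) \<inter> A \<subseteq> X \<inter> \<Inter>H \<inter> A" using that by blast
    ultimately show False using p[of "G \<union> H"] that by (meson finite_UnI finite_subset le_sup_iff)
  qed
  show thesis
  proof
    show "infinite (X \<inter> A)" if "X \<in> p" for X using p[of "{X}"] that by simp
    show "X \<inter> Y \<in> p" if "X \<in> p" "Y \<in> p" for X Y using into[of "{X, Y}"] that by simp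
    show "X \<in> p \<or> - X \<in> p" for X
    proof (rule ccontr)
      assume "\<not> (X \<in> p \<or> - X \<in> p)"
      then obtain G H where "finite G" "G \<subseteq> p" "finite (X \<inter> \<Inter>G \<inter> A)"
        "finite H" "H \<subseteq> p" "finite (- X \<inter> \<Inter>H \<inter> A)"
        using out by meson
      moreover from this have "infinite (\<Inter>(G \<union> H) \<inter> A)" by (intro p) auto
      moreover have "\<Inter>(G \<union> H) \<inter> A \<subseteq> (X \<inter> \<Inter>G \<inter> A) \<union> (- X \<inter> \<Inter>H \<inter> A)" by blast
      ultimately show False by (meson finite_UnI finite_subset)
    qed
  qed
qed

section \<open>Consistent triples\<close>

lemma consistent_rotate: "consistent C S x y z \<longleftrightarrow> consistent C S y z x"
  unfolding consistent_def by (auto simp: insert_commute)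

text \<open>An infinite trace supplies proper colours \<open>c\<close>, \<open>d\<close> distinct
  from \<open>x\<close> and from each other: \<open>x, c, c\<close> has two values and
  \<open>x, c, d\<close> three, and \<open>S\<close> allows one of these. For
  \<open>x = None\<close>, \<open>c\<close> is taken twice.\<close>

lemma consistent_in_infinite:
  assumes "infinite (W \<inter> Some ` C)" and "S \<inter> {2, 3} \<noteq> {}" and "x \<in> colours_plus C"
  shows "\<exists>y\<in>W. \<exists>z\<in>W. consistent C S x y z"
proof -
  obtain c where c: "c \<in> W \<inter> Some ` C" "c \<noteq> x"
    using infinite_remove[OF assms(1), of x] by (metis Diff_iff all_not_in_conv finite.emptyI singletonI)
  have "infinite (W \<inter> Some ` C - {x, c})" using assms(1) by simp
  then obtain d where d: "d \<in> W \<inter> Some ` C" "d \<noteq> x" "d \<noteq> c"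
    by (metis Diff_iff all_not_in_conv finite.emptyI insertCI)
  show ?thesis
  proof (cases "x = None")
    case True
    with c have "consistent C S x c c" by (auto simp: consistent_def colours_plus_def)
    with c show ?thesis by blast
  next
    case False
    then have x: "x \<in> Some ` C" using assms(3) by (auto simp: colours_plus_def)
    have card: "card {x, c, c} = 2" "card {x, c, d} = 3" using c d by auto
    have "card {x, c, c} \<in> S \<or> card {x, c, d} \<in> S" unfolding card using assms(2) by blast
    then have "consistent C S x c c \<or> consistent C S x c d"
      using x c d unfolding consistent_def colours_plus_def by blast
    with c d show ?thesis by blast
  qed
qed

section \<open>Triangles of colours\<close>

text \<open>On vertices 0, 1, 2 the sum \<open>i + j\<close> identifies the edge: \<open>a\<close>
  lies on {0, 1}, \<open>b\<close> on {1, 2} and \<open>c\<close> on {0, 2}.\<close>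

definition edge_colour :: "'c \<times> 'c \<times> 'c \<Rightarrow> nat \<Rightarrow> nat \<Rightarrow> 'c option" where
  "edge_colour t i j = (case t of (a, b, c) \<Rightarrow>
     if i = j then None else if i + j = 1 then Some a else if i + j = 2 then Some c else Some b)"

text \<open>
  The index set consists of all triples of colours; an inconsistent triple loses its third vertex.
  The edge \<open>{0, 1}\<close> over \<open>(a, a, a)\<close> makes every colour \<open>a\<close> occur, even if \<open>1 \<notin> S\<close>.
\<close>

definition triangle_points :: "'c set \<Rightarrow> nat set \<Rightarrow> (('c \<times> 'c \<times> 'c) \<times> nat) set" where
  "triangle_points C S = {((a, b, c), i). a \<in> C \<and> b \<in> C \<and> c \<in> C \<and>
     (i < 2 \<or> i = 2 \<and> card {a, b, c} \<in> S)}"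

definition pair_label :: "'c option set set \<Rightarrow> ('c \<times> 'c \<times> 'c) \<times> nat \<Rightarrow>
    ('c \<times> 'c \<times> 'c) \<times> nat \<Rightarrow> 'c option set set" where
  "pair_label p u v = (if fst u = fst v then {X. edge_colour (fst u) (snd u) (snd v) \<in> X} else p)"

lemma edge_colour_in:
  "(t, i) \<in> triangle_points C S \<Longrightarrow> edge_colour t i j \<in> colours_plus C"
  by (auto simp: triangle_points_def edge_colour_def colours_plus_def split: if_splits)

lemma edge_colour_commute: "edge_colour t i j = edge_colour t j i"
  by (auto simp: edge_colour_def add.commute split: prod.split)

lemma card_Some_triple: "card {Some a, Some b, Some c} = card {a, b, c}"
  using card_image[OF inj_Some, of "{a, b, c}"] by (simp only: image_empty image_insert)

text \<open>Coinciding vertices give an identity edge and two equal ones; distinct vertices carry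
  \<open>a, b, c\<close> in some order, and vertex 2 is present only if
  \<open>card {a, b, c} \<in> S\<close>.\<close>

lemma edge_colour_consistent:
  assumes "(t, i) \<in> triangle_points C S" "(t, j) \<in> triangle_points C S" "(t, k) \<in> triangle_points C S"
  shows "consistent C S (edge_colour t i j) (edge_colour t j k) (edge_colour t i k)"
proof -
  obtain a b c where t: "t = (a, b, c)" by (cases t)
  have "i \<in> {0, 1, 2}" "j \<in> {0, 1, 2}" "k \<in> {0, 1, 2}"
    using assms by (auto simp: triangle_points_def)
  then show ?thesis
    using assms card_Some_triple[of a b c] unfolding t
    by (elim insertE emptyE; simp add: triangle_points_def edge_colour_def consistent_def
        colours_plus_def insert_commute)
qed

text \<open>A proper triple is realized by the triangle it indexes. A triple containing
  \<open>None\<close> needs at most two points, and the edge {0, 1} over \<open>(a, a, a)\<close> is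
  present for every \<open>S\<close>.\<close>

lemma consistent_realized:
  assumes cons: "consistent C S x y z" and "C \<noteq> {}"
  shows "\<exists>t i j k. (t, i) \<in> triangle_points C S \<and> (t, j) \<in> triangle_points C S \<and>
    (t, k) \<in> triangle_points C S \<and>
    edge_colour t i j = x \<and> edge_colour t j k = y \<and> edge_colour t i k = z"
proof (cases "None \<in> {x, y, z}")
  case True
  \<comment> \<open>\<open>a0\<close> serves the triple of three identities, which names no proper
    colour.\<close>
  obtain a0 where "a0 \<in> C" using assms(2) by blast
  then obtain a where a: "a \<in> C" and sub: "{x, y, z} \<subseteq> {None, Some a}"
    using cons True unfolding consistent_def colours_plus_def by fastforce
  let ?t = "(a, a, a)"
  have pts: "(?t, 0) \<in> triangle_points C S" "(?t, 1) \<in> triangle_points C S"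
    using a by (simp_all add: triangle_points_def)
  have col: "edge_colour ?t 0 0 = None" "edge_colour ?t 1 1 = None"
    "edge_colour ?t 0 1 = Some a" "edge_colour ?t 1 0 = Some a"
    by (simp_all add: edge_colour_def)
  consider "x = None" "y = None" "z = None" | "x = None" "y = Some a" "z = Some a"
    | "x = Some a" "y = None" "z = Some a" | "x = Some a" "y = Some a" "z = None"
    using cons True sub unfolding consistent_def by auto
  then show ?thesis using pts col by cases metis+
next
  case False
  with cons obtain a b c where abc: "x = Some a" "y = Some b" "z = Some c"
    "a \<in> C" "b \<in> C" "c \<in> C" "card {Some a, Some b, Some c} \<in> S"
    unfolding consistent_def by auto
  then show ?thesis
    by (intro exI[of _ "(a, b, c)"] exI[of _ 0] exI[of _ 1] exI[of _ 2])
      (simp add: card_Some_triple triangle_points_def edge_colour_def)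
qed

section \<open>Representation when \<open>S\<close> meets {2, 3}\<close>

text \<open>The ultrafilter laws of the labels give the Boolean operations. For composition,
  \<open>triangle\<close> yields the relational inclusions, while \<open>realized\<close> yields the
  converse and injectivity.\<close>

lemma triangle_representation:
  assumes inf: "infinite C" and S: "S \<inter> {2, 3} \<noteq> {}"
    and p1: "\<And>X. X \<in> p \<Longrightarrow> infinite (X \<inter> Some ` C)"
    and p2: "\<And>X Y. X \<in> p \<Longrightarrow> Y \<in> p \<Longrightarrow> X \<inter> Y \<in> p"
    and p3: "\<And>X. X \<in> p \<or> - X \<in> p"
  shows "qualitative_representation (chromatic_algebra C S) (triangle_points C S)
    (\<lambda>X. {(u, v) \<in> triangle_points C S \<times> triangle_points C S. X \<in> pair_label p u v})"
    (is "qualitative_representation ?A ?U ?phi")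
proof -
  have p_Compl: "- X \<in> p \<longleftrightarrow> X \<notin> p" for X
    using p1[OF p2[of X "- X"]] p3[of X] by auto
  \<comment> \<open>Only the proper colours in a set matter: otherwise \<open>X \<inter> - Y\<close>
    would be in \<open>p\<close> with an empty trace.\<close>
  have p_mono: "Y \<in> p" if "X \<in> p" "X \<inter> Some ` C \<subseteq> Y" for X Y
  proof (rule ccontr)
    assume "Y \<notin> p"
    then have "infinite (X \<inter> - Y \<inter> Some ` C)" using p1[OF p2] p_Compl that by blast
    moreover have "X \<inter> - Y \<inter> Some ` C = {}" using that by blast
    ultimately show False by simp
  qed
  have p_empty: "{} \<notin> p" using p1 by force
  have p_Int: "X \<inter> Y \<in> p \<longleftrightarrow> X \<in> p \<and> Y \<in> p" for X Y using p2 p_mono by blast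
  have p_Un: "X \<union> Y \<in> p \<longleftrightarrow> X \<in> p \<or> Y \<in> p" for X Y
    using p_Int[of "- X" "- Y"] p_Compl by (metis compl_sup)
  have p_top: "colours_plus C \<in> p"
    using p_mono[of UNIV] p_empty p_Compl[of UNIV] by (auto simp: colours_plus_def)
  have p_diff: "colours_plus C - X \<in> p \<longleftrightarrow> X \<notin> p" for X
    using p_Int[of "colours_plus C" "- X"] p_top p_Compl by (simp add: Diff_eq)
  have lab: "{} \<notin> pair_label p u v" "colours_plus C \<in> pair_label p u v"
    "X \<inter> Y \<in> pair_label p u v \<longleftrightarrow> X \<in> pair_label p u v \<and> Y \<in> pair_label p u v"
    "X \<union> Y \<in> pair_label p u v \<longleftrightarrow> X \<in> pair_label p u v \<or> Y \<in> pair_label p u v"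
    "colours_plus C - X \<in> pair_label p u v \<longleftrightarrow> X \<notin> pair_label p u v"
    if "u \<in> ?U" for u v X Y
    using that p_empty p_top p_Int p_Un p_diff edge_colour_in[of "fst u" "snd u" C S "snd v"]
    by (auto simp: pair_label_def)
  have lab_commute: "pair_label p u v = pair_label p v u" for u v
    by (auto simp: pair_label_def edge_colour_commute)
  have lab_None: "{None} \<in> pair_label p u v \<longleftrightarrow> u = v" for u v
  proof -
    have "{None} \<notin> p" using p1[of "{None}"] by auto
    then show ?thesis
      by (auto simp: pair_label_def edge_colour_def prod_eq_iff split: prod.split)
  qed
  \<comment> \<open>This replaces consistency of the three edge colours once labels may be
    nonprincipal.\<close>
  have triangle: "\<exists>x\<in>X. \<exists>y\<in>Y. \<exists>z\<in>Z. consistent C S x y z"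
    if U: "u \<in> ?U" "v \<in> ?U" "w \<in> ?U"
      and X: "X \<in> pair_label p u v" and Y: "Y \<in> pair_label p v w" and Z: "Z \<in> pair_label p u w"
    for u v w X Y Z
  proof -
    have pick: "\<exists>y\<in>V. \<exists>z\<in>W. consistent C S x y z"
      if "V \<in> p" "W \<in> p" "x \<in> colours_plus C" for V W x
      using consistent_in_infinite[OF p1[OF p2] S] that by fast
    have col: "edge_colour (fst u) (snd u) i \<in> colours_plus C"
      "edge_colour (fst v) (snd v) i \<in> colours_plus C" for i
      using U by (auto intro: edge_colour_in)
    consider "fst u = fst v" "fst v = fst w" | "fst u = fst v" "fst v \<noteq> fst w"
      | "fst u \<noteq> fst v" "fst v = fst w" | "fst u = fst w" "fst u \<noteq> fst v"
      | "fst u \<noteq> fst v" "fst v \<noteq> fst w" "fst u \<noteq> fst w" by metis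
    then show ?thesis
    proof cases
      case 1
      have "consistent C S (edge_colour (fst u) (snd u) (snd v))
        (edge_colour (fst u) (snd v) (snd w)) (edge_colour (fst u) (snd u) (snd w))"
        using edge_colour_consistent[of "fst u" "snd u" C S "snd v" "snd w"] U 1
        by (metis prod.collapse)
      with 1 X Y Z show ?thesis by (auto simp: pair_label_def)
    next
      case 2
      with X Y Z pick[of Y Z] col show ?thesis by (fastforce simp: pair_label_def)
    next
      case 3
      then have "edge_colour (fst v) (snd v) (snd w) \<in> Y" "Z \<in> p" "X \<in> p"
        using X Y Z by (auto simp: pair_label_def)
      \<comment> \<open>\<open>pick\<close> puts the principal colour, that of the edge from
        \<open>v\<close> to \<open>w\<close>, in first place; rotation moves it to the
        second.\<close>
      with pick[of Z X] col show ?thesis by (metis consistent_rotate)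
    next
      case 4
      then have "edge_colour (fst u) (snd u) (snd w) \<in> Z" "X \<in> p" "Y \<in> p"
        using X Y Z by (auto simp: pair_label_def)
      with pick[of X Y] col show ?thesis by (metis consistent_rotate)
    next
      case 5
      then have "X \<in> p" "Y \<in> p" "Z \<in> p" using X Y Z by (auto simp: pair_label_def)
      \<comment> \<open>With no principal label, any proper colour of \<open>X\<close> serves as the
        fixed one.\<close>
      moreover from this obtain c where "c \<in> X" "c \<in> Some ` C"
        using p1[of X] by (metis IntE finite.emptyI ex_in_conv)
      ultimately show ?thesis using pick[of Y Z c] by (auto simp: colours_plus_def)
    qed
  qed
  have realized: "\<exists>u v w. u \<in> ?U \<and> v \<in> ?U \<and> w \<in> ?U \<and> pair_label p u v = {X. x \<in> X} \<and>
      pair_label p v w = {Y. y \<in> Y} \<and> pair_label p u w = {Z. z \<in> Z}"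
    if xyz: "consistent C S x y z" for x y z
  proof -
    obtain t i j k where "(t, i) \<in> ?U" "(t, j) \<in> ?U" "(t, k) \<in> ?U"
      "edge_colour t i j = x" "edge_colour t j k = y" "edge_colour t i k = z"
      using consistent_realized[OF xyz] inf by fastforce
    then show ?thesis
      by (intro exI[of _ "(t, i)"] exI[of _ "(t, j)"] exI[of _ "(t, k)"])
        (simp add: pair_label_def)
  qed
  have inj: "inj_on ?phi (Pow (colours_plus C))"
  proof (rule inj_onI, rule ccontr)
    fix X Y assume XY: "X \<in> Pow (colours_plus C)" "Y \<in> Pow (colours_plus C)"
      and eq: "?phi X = ?phi Y" and "X \<noteq> Y"
    then obtain x where x: "x \<in> colours_plus C" "(x \<in> X) \<noteq> (x \<in> Y)" by blast
    \<comment> \<open>Realizing this triple yields a pair with principal label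
      \<open>x\<close>.\<close>
    then have "consistent C S None x x" by (simp add: consistent_def colours_plus_def)
    from realized[OF this] obtain v w where "v \<in> ?U" "w \<in> ?U"
      "pair_label p v w = {X. x \<in> X}" by (elim exE conjE)
    with x(2) have "((v, w) \<in> ?phi X) \<noteq> ((v, w) \<in> ?phi Y)" by simp
    with eq show False by simp
  qed
  have comp: "?phi X O ?phi Y \<subseteq> ?phi Z \<longleftrightarrow>
      {z. \<exists>x\<in>X. \<exists>y\<in>Y. consistent C S x y z} \<subseteq> Z" (is "_ \<longleftrightarrow> ?XY \<subseteq> Z") for X Y Z
  proof
    assume sub: "?phi X O ?phi Y \<subseteq> ?phi Z"
    show "?XY \<subseteq> Z"
    proof clarify
      fix x y z assume "x \<in> X" "y \<in> Y" "consistent C S x y z"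
      moreover from realized[OF this(3)] obtain u v w where "u \<in> ?U" "v \<in> ?U" "w \<in> ?U"
        "pair_label p u v = {X. x \<in> X}" "pair_label p v w = {Y. y \<in> Y}"
        "pair_label p u w = {Z. z \<in> Z}" by (elim exE conjE)
      moreover from calculation have "(u, v) \<in> ?phi X" "(v, w) \<in> ?phi Y" by simp_all
      then have "(u, w) \<in> ?phi Z" using sub by (meson relcomp.relcompI subsetD)
      ultimately show "z \<in> Z" by simp
    qed
  next
    assume sub: "?XY \<subseteq> Z"
    show "?phi X O ?phi Y \<subseteq> ?phi Z"
    proof (rule subrelI)
      fix u w assume "(u, w) \<in> ?phi X O ?phi Y"
      then obtain v where *: "u \<in> ?U" "v \<in> ?U" "w \<in> ?U"
        "X \<in> pair_label p u v" "Y \<in> pair_label p v w" by blast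
      have "Z \<in> pair_label p u w"
      proof (rule ccontr)
        assume "Z \<notin> pair_label p u w"
        \<comment> \<open>The complement of \<open>Z\<close> belongs to the label, so some
          consistent triple would end outside \<open>Z\<close>.\<close>
        then have "colours_plus C - Z \<in> pair_label p u w" using lab(5)[OF *(1)] by blast
        from triangle[OF * this] sub show False by blast
      qed
      with * show "(u, w) \<in> ?phi Z" by simp
    qed
  qed
  have sel: "univ ?A = Pow (colours_plus C)" "join ?A = (\<union>)" "meet ?A = (\<inter>)"
    "compl ?A = (\<lambda>X. colours_plus C - X)" "bottom ?A = {}" "unit ?A = colours_plus C"
    "ident ?A = {None}" "conv ?A = (\<lambda>X. X)"
    "comp ?A = (\<lambda>X Y. {z. \<exists>x\<in>X. \<exists>y\<in>Y. consistent C S x y z})"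
    by (simp_all add: chromatic_algebra_def)
  have phi: "?phi X \<subseteq> ?U \<times> ?U" "?phi (X \<union> Y) = ?phi X \<union> ?phi Y" "?phi (X \<inter> Y) = ?phi X \<inter> ?phi Y"
    "?phi (colours_plus C - X) = ?U \<times> ?U - ?phi X" "?phi {} = {}" "?phi (colours_plus C) = ?U \<times> ?U"
    "?phi {None} = Id_on ?U" "?phi X = (?phi X)\<inverse>" for X Y
    by (auto simp: lab lab_None lab_commute)
  show ?thesis
    unfolding qualitative_representation_def leq_chromatic_algebra sel
    by (intro conjI ballI) (rule inj phi comp)+
qed

section \<open>Non-representability when \<open>S\<close> is contained in {1}\<close>

lemma no_representation:
  assumes rep: "qualitative_representation (chromatic_algebra C S) U \<phi>"
    and "infinite C" and "S \<subseteq> {1}"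
  shows False
proof -
  let ?A = "chromatic_algebra C S"
  have sel: "univ ?A = Pow (colours_plus C)" "unit ?A = colours_plus C" "bottom ?A = {}"
    "comp ?A X Y = {z. \<exists>x\<in>X. \<exists>y\<in>Y. consistent C S x y z}" for X Y
    by (simp_all add: chromatic_algebra_def)
  note R = qualitative_representationD[OF rep, unfolded leq_chromatic_algebra sel]
  obtain a where a: "a \<in> C" using assms(2) by fastforce
  have "infinite (C - {a})" using assms(2) by simp
  then obtain b where b: "b \<in> C" "b \<noteq> a" by (metis Diff_iff ex_in_conv finite.emptyI insertCI)
  \<comment> \<open>\<open>D\<close> is closed under composition; its image will fill
    \<open>U \<times> U\<close>, although \<open>D\<close> misses \<open>b\<close>.\<close>
  define D where "D = {None, Some a}"
  have D: "D \<subseteq> colours_plus C" "{Some a} \<subseteq> colours_plus C" "colours_plus C - D \<subseteq> colours_plus C"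
    using a by (auto simp: D_def colours_plus_def)
  have cons: "x = y \<and> z = x" if "consistent C S x y z" "x \<noteq> None" "y \<noteq> None" "z \<noteq> None" for x y z
  proof -
    have "card {x, y, z} = 1" using that assms(3) unfolding consistent_def by auto
    then obtain c where "{x, y, z} = {c}" by (rule card_1_singletonE)
    then show ?thesis by blast
  qed
  have DD: "\<phi> D O \<phi> D \<subseteq> \<phi> D"
  proof (subst R(10))
    show "{z. \<exists>x\<in>D. \<exists>y\<in>D. consistent C S x y z} \<subseteq> D"
      using cons unfolding D_def consistent_def by fastforce
  qed (use D in auto)
  have aD: "\<phi> {Some a} O \<phi> (colours_plus C - D) \<subseteq> \<phi> {}"
  proof (subst R(10))
    have False if c: "y \<in> colours_plus C - D" "consistent C S (Some a) y z" for y z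
    proof (cases "z = None")
      case True
      with c show False by (auto simp: D_def consistent_def)
    next
      case False
      with c cons[of "Some a" y z] show False by (auto simp: D_def)
    qed
    then show "{z. \<exists>x\<in>{Some a}. \<exists>y\<in>colours_plus C - D. consistent C S x y z} \<subseteq> {}" by auto
  qed (use D in auto)
  have compl: "\<phi> (colours_plus C - D) = U \<times> U - \<phi> D"
    using R(5)[of D] D by (simp add: chromatic_algebra_def)
  have conv: "\<phi> X = (\<phi> X)\<inverse>" if "X \<subseteq> colours_plus C" for X
    using R(9)[of X] that by (simp add: chromatic_algebra_def)
  have "\<phi> {Some a} \<noteq> {}"
    using inj_onD[OF R(1), of "{Some a}" "{}"] R(6) D by auto
  then obtain u v where uv: "(u, v) \<in> \<phi> {Some a}" by auto
  then have U: "u \<in> U" "v \<in> U" using R(2)[of "{Some a}"] D by auto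
  \<comment> \<open>A pair \<open>(v, w)\<close> outside \<open>\<phi> D\<close> would put
    \<open>(u, w)\<close> into \<open>\<phi> {} = {}\<close>.\<close>
  have vD: "(v, w) \<in> \<phi> D" if "w \<in> U" for w using aD compl uv U R(6) that by blast
  have "\<phi> D = U \<times> U"
  proof
    show "\<phi> D \<subseteq> U \<times> U" using R(2) D by simp
    show "U \<times> U \<subseteq> \<phi> D"
    proof clarify
      fix w w' assume "w \<in> U" "w' \<in> U"
      \<comment> \<open>Any two points are joined through \<open>v\<close>; symmetry of
        \<open>\<phi> D\<close> reverses the first edge.\<close>
      then have "(w, v) \<in> \<phi> D" "(v, w') \<in> \<phi> D" using vD conv[OF D(1)] by blast+
      then show "(w, w') \<in> \<phi> D" using DD by blast
    qed
  qed
  then have "D = colours_plus C" using inj_onD[OF R(1), of D "colours_plus C"] R(7) D by simp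
  then show False using b by (auto simp: D_def colours_plus_def)
qed

theorem theorem33:
  fixes C :: "'c set" and S :: "nat set"
  assumes "infinite C" and "S \<subseteq> {1, 2, 3}"
  shows "has_qualitative_representation (chromatic_algebra C S) \<longleftrightarrow> S \<inter> {2, 3} \<noteq> {}"
proof
  assume "has_qualitative_representation (chromatic_algebra C S)"
  then obtain U and \<phi> :: "'c option set \<Rightarrow> ('c option set list \<times> 'c option set list) set"
    where rep: "qualitative_representation (chromatic_algebra C S) U \<phi>"
    unfolding has_qualitative_representation_def by (elim exE)
  show "S \<inter> {2, 3} \<noteq> {}"
  proof
    assume "S \<inter> {2, 3} = {}"
    then have "S \<subseteq> {1}" using assms(2) by blast
    with rep assms(1) show False by (rule no_representation)
  qed
next
  assume S: "S \<inter> {2, 3} \<noteq> {}"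
  have "infinite (Some ` C)" using assms(1) by (simp add: finite_image_iff)
  then show "has_qualitative_representation (chromatic_algebra C S)"
  proof (rule nonprincipal_ultrafilter_exists)
    fix p assume "\<And>X. X \<in> p \<Longrightarrow> infinite (X \<inter> Some ` C)"
      "\<And>X Y. X \<in> p \<Longrightarrow> Y \<in> p \<Longrightarrow> X \<inter> Y \<in> p" "\<And>X. X \<in> p \<or> - X \<in> p"
    \<comment> \<open>The base of triangle vertices is exchanged for one consisting of
      lists.\<close>
    from triangle_representation[OF assms(1) S this]
    show ?thesis by (rule has_qualitative_representationI)
  qed
qed

end
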